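(* Let $s\ge 1$ and $q$ be integers with $0\le q\le s$, and let $n=T_s+q$. Let $M_n=\{\lambda\vdash n:\deg(\lambda)=\Delta_n\}$ be the set of degree-maximizing partitions of $n$, and let $\Pi_n=\{(A(\lambda),B(\lambda)):\lambda\in M_n\}$ be the set of realized maximizing profiles. Then $$\Pi_n=\mathcal P(q):=\{(a,b)\in\mathbb Z_{\ge 0}^2:\ a+b=\rho(q),\ T_a+T_b\le q\},$$ where $\rho(q):=\max\{a+b:\ a,b\in\mathbb Z_{\ge 0},\ T_a+T_b\le q\}$.
   Context: For an integer $m\ge 0$, $T_m:=m(m+1)/2$. Compressed form: a partition $\lambda$ is written $\lambda=(L_1^{m_1},\dots,L_r^{m_r})$ with $L_1>\cdots>L_r>0$ its distinct part sizes and $m_i\ge 1$ the multiplicity of $L_i$. Gaps: $g_i=L_i-L_{i+1}$ for $1\le i<r$ and $g_r=L_r$. Set $A(\lambda):=\#\{i:g_i>1\}$ and $B(\lambda):=\#\{i:m_i>1\}$. Partition graph: for $n\ge 1$, $G_n$ is the simple graph whose vertices are the integer partitions of $n$; two distinct partitions are adjacent if one is obtained from the other by an elementary transfer of one unit from one part to another (subtract $1$ from one part and add $1$ to another part), followed by reordering. Here the receiving part may be a zero part (so a new part $1$ may be created), and parts that become $0$ are discarded. $\deg(\lambda)$ is the degree of $\lambda$ in $G_n$, and $\Delta_n:=\max_{\lambda\vdash n}\deg(\lambda)$. *)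

theory Defs
  imports "HOL-Library.Multiset"
begin

definition tri :: "nat \<Rightarrow> nat" where
  "tri m = m * (m + 1) div 2"

definition partitions :: "nat \<Rightarrow> nat multiset set" where
  "partitions n = {p. 0 \<notin># p \<and> sum_mset p = n}"

text \<open>
  The compressed form \<open>(L\<^sub>1\<^bsup>m\<^sub>1\<^esup>, \<dots>, L\<^sub>r\<^bsup>m\<^sub>r\<^esup>)\<close> is read off from the multiset. Indices are shifted by
  one: \<open>L\<^sub>1, \<dots>, L\<^sub>r\<close> are the entries \<open>0, \<dots>, r - 1\<close> of the list \<open>part_sizes p\<close>.
\<close>

definition part_sizes :: "nat multiset \<Rightarrow> nat list" where
  "part_sizes p = rev (sorted_list_of_set (set_mset p))"

definition multiplicity_at :: "nat multiset \<Rightarrow> nat \<Rightarrow> nat" where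
  "multiplicity_at p i = count p (part_sizes p ! i)"

definition gap_at :: "nat multiset \<Rightarrow> nat \<Rightarrow> nat" where
  "gap_at p i =
    (if i + 1 < length (part_sizes p) then part_sizes p ! i - part_sizes p ! (i + 1)
     else part_sizes p ! i)"

definition large_gaps :: "nat multiset \<Rightarrow> nat" where
  "large_gaps p = card {i. i < length (part_sizes p) \<and> gap_at p i > 1}"

definition repeated_sizes :: "nat multiset \<Rightarrow> nat" where
  "repeated_sizes p = card {i. i < length (part_sizes p) \<and> multiplicity_at p i > 1}"

text \<open>
  One unit moves from a part \<open>x\<close> to another part \<open>y\<close>. The copy of \<open>0\<close> added to \<open>p\<close> is the zero
  part, which may receive but not give; \<open>x\<close> and \<open>y\<close> are distinct occurrences, though they may have
  equal size. The filter discards the zero parts.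
\<close>

definition transfer :: "nat multiset \<Rightarrow> nat multiset \<Rightarrow> bool" where
  "transfer p p' \<longleftrightarrow>
    (\<exists>x y. x > 0 \<and> {#x, y#} \<subseteq># add_mset 0 p \<and>
       p' = filter_mset (\<lambda>z. z > 0) (add_mset 0 p - {#x, y#} + {#x - 1, y + 1#}))"

definition adjacent :: "nat \<Rightarrow> nat multiset \<Rightarrow> nat multiset \<Rightarrow> bool" where
  "adjacent n p p' \<longleftrightarrow>
    p \<in> partitions n \<and> p' \<in> partitions n \<and> p \<noteq> p' \<and> (transfer p p' \<or> transfer p' p)"

definition deg :: "nat \<Rightarrow> nat multiset \<Rightarrow> nat" where
  "deg n p = card {p'. adjacent n p p'}"

definition max_deg :: "nat \<Rightarrow> nat" where
  "max_deg n = Max (deg n ` partitions n)"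

definition maximizers :: "nat \<Rightarrow> nat multiset set" where
  "maximizers n = {p \<in> partitions n. deg n p = max_deg n}"

definition maximizing_profiles :: "nat \<Rightarrow> (nat \<times> nat) set" where
  "maximizing_profiles n = (\<lambda>p. (large_gaps p, repeated_sizes p)) ` maximizers n"

definition rho :: "nat \<Rightarrow> nat" where
  "rho q = Max {a + b | a b. tri a + tri b \<le> q}"

definition predicted_profiles :: "nat \<Rightarrow> (nat \<times> nat) set" where
  "predicted_profiles q = {(a, b). a + b = rho q \<and> tri a + tri b \<le> q}"

lemma size_le_sum_mset: "0 \<notin># p \<Longrightarrow> size p \<le> sum_mset p" for p :: "nat multiset"
  by (induction p) auto

lemma finite_partitions: "finite (partitions n)"
proof (rule finite_subset)
  show "partitions n \<subseteq> mset ` {xs. set xs \<subseteq> {..n} \<and> length xs \<le> n}"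
  proof
    fix p assume "p \<in> partitions n"
    then have p: "0 \<notin># p" "sum_mset p = n" by (auto simp: partitions_def)
    obtain xs where xs: "mset xs = p" using ex_mset by blast
    have "x \<le> n" if "x \<in># p" for x
      using that p(2) by (metis le_add1 multi_member_split sum_mset.add_mset)
    moreover have "length xs \<le> n"
      using size_le_sum_mset[OF p(1)] p(2) xs by (metis size_mset)
    ultimately show "p \<in> mset ` {xs. set xs \<subseteq> {..n} \<and> length xs \<le> n}"
      using xs by (auto intro!: image_eqI[of _ _ xs])
  qed
  show "finite (mset ` {xs. set xs \<subseteq> {..n} \<and> length xs \<le> n})"
    by (intro finite_imageI finite_lists_length_le) simp
qed

lemma partitions_nonempty: "partitions n \<noteq> {}"
proof -
  have "replicate_mset n 1 \<in> partitions n"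
    by (auto simp: partitions_def)
  then show ?thesis by blast
qed

lemma le_tri: "m \<le> tri m"
  by (cases m) (auto simp: tri_def)

lemma finite_rho_set: "finite {a + b | a b. tri a + tri b \<le> q}"
proof (rule finite_subset)
  show "{a + b | a b. tri a + tri b \<le> q} \<subseteq> {..q}"
    using add_mono[OF le_tri le_tri] order_trans by fastforce
qed simp

lemma rho_set_nonempty: "{a + b | a b. tri a + tri b \<le> q} \<noteq> {}"
proof -
  have "tri 0 + tri 0 \<le> q" by (simp add: tri_def)
  then show ?thesis by blast
qed

end

theory Submission
  imports Defs
begin

text \<open>
  The transfer from a part \<open>x\<close> to a part \<open>y\<close> removes one cell from the \<open>x\<close>-th column of the Young
  diagram and adds one to the \<open>(y + 1)\<close>-st. So a nontrivial transfer is determined by the pair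
  \<open>(x, y)\<close>, and counting the admissible pairs gives \<open>deg \<lambda> = r (r - 1) + A(\<lambda>) + B(\<lambda>)\<close>, where \<open>r\<close> is
  the number of distinct part sizes. The smallest partition with given \<open>r\<close>, \<open>A\<close>, \<open>B\<close> has size at least
  \<open>T\<^sub>r + T\<^sub>A + T\<^sub>B\<close>. For \<open>n = T\<^sub>s + q\<close> this forces \<open>r \<le> s\<close>, and \<open>r = s\<close> for a maximizer; since \<open>q \<le> s\<close>,
  the large gaps can be put at the largest parts and the repetitions at the smallest ones without
  interaction, so that every \<open>(a, b)\<close> with \<open>T\<^sub>a + T\<^sub>b \<le> q\<close> occurs with \<open>r = s\<close>.
\<close>

section \<open>Triangular numbers\<close>

lemma tri_0 [simp]: "tri 0 = 0"
  by (simp add: tri_def)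

lemma tri_Suc [simp]: "tri (Suc m) = tri m + Suc m"
  by (simp add: tri_def)

lemma double_tri: "2 * tri m = m * (m + 1)"
  by (induction m) auto

lemma tri_add: "tri (a + b) = tri a + tri b + a * b"
  by (induction a) auto

lemma tri_mono: "a \<le> b \<Longrightarrow> tri a \<le> tri b"
  using tri_add[of a "b - a"] by simp

section \<open>Profiles in terms of the set of part sizes\<close>

text \<open>The inserted \<open>0\<close> serves as the size below the smallest part, in accordance
  with \<open>g_r = L_r\<close>; thus \<open>1\<close> never tops a large gap.\<close>

definition gap_tops :: "nat set \<Rightarrow> nat set" where
  "gap_tops S = {x \<in> S. x - 1 \<notin> insert 0 S}"

lemma part_sizes_props:
  shows set_part_sizes: "set (part_sizes p) = set_mset p"
    and distinct_part_sizes: "distinct (part_sizes p)"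
    and length_part_sizes: "length (part_sizes p) = card (set_mset p)"
  by (simp_all add: part_sizes_def)

lemma part_sizes_strict_antimono:
  assumes "i < j" "j < length (part_sizes p)"
  shows "part_sizes p ! j < part_sizes p ! i"
proof -
  let ?xs = "sorted_list_of_set (set_mset p)"
  have "sorted_wrt (<) ?xs" by simp
  then have "sorted_wrt (>) (part_sizes p)"
    by (simp add: part_sizes_def sorted_wrt_rev)
  then show ?thesis using assms sorted_wrt_nth_less by blast
qed

text \<open>Turns the counts over indices in \<open>large_gaps\<close> and
  \<open>repeated_sizes\<close> into counts over the sizes themselves.\<close>

lemma bij_betw_part_sizes_filter:
  "bij_betw ((!) (part_sizes p))
     {i. i < length (part_sizes p) \<and> Q (part_sizes p ! i)} {x \<in> set_mset p. Q x}"
proof -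
  have "(!) (part_sizes p) ` {i. i < length (part_sizes p) \<and> Q (part_sizes p ! i)}
      = {x \<in> set (part_sizes p). Q x}"
    by (auto simp: in_set_conv_nth)
  then show ?thesis
    by (auto simp: bij_betw_def inj_on_def set_part_sizes distinct_part_sizes
        nth_eq_iff_index_eq)
qed

text \<open>No size lies strictly between two consecutive ones, so a gap of \<open>1\<close> means
  exactly that the predecessor is present.\<close>

lemma gap_at_gt_1_iff:
  assumes i: "i < length (part_sizes p)" and "0 \<notin># p"
  shows "gap_at p i > 1 \<longleftrightarrow> part_sizes p ! i - 1 \<notin> insert 0 (set_mset p)"
proof -
  let ?L = "part_sizes p"
  have pos: "?L ! j > 0" if "j < length ?L" for j
    using that assms(2) by (metis nth_mem set_part_sizes gr0I)
  show ?thesis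
  proof (cases "i + 1 < length ?L")
    case True
    have less: "?L ! (i + 1) < ?L ! i"
      using True by (intro part_sizes_strict_antimono) auto
    have none_between: "\<not> (?L ! (i + 1) < x \<and> x < ?L ! i)" if x: "x \<in># p" for x
    proof -
      obtain j where j: "j < length ?L" "x = ?L ! j"
        using x unfolding set_part_sizes[symmetric] in_set_conv_nth by blast
      consider "j < i" | "j = i" | "j = i + 1" | "i + 1 < j" by linarith
      then show ?thesis
      proof cases
        case 1
        then show ?thesis using part_sizes_strict_antimono[of j i p] i j by simp
      next
        case 4
        then show ?thesis using part_sizes_strict_antimono[of "i + 1" j p] j by simp
      qed (simp_all add: j)
    qed
    have next_in: "?L ! (i + 1) \<in># p" using nth_mem[OF True] by (simp only: set_part_sizes)
    have gap: "gap_at p i = ?L ! i - ?L ! (i + 1)" using True by (simp add: gap_at_def)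
    show ?thesis
    proof (cases "?L ! i = ?L ! (i + 1) + 1")
      case True
      then show ?thesis unfolding gap using next_in by simp
    next
      case False
      then have "?L ! (i + 1) < ?L ! i - 1" using less by linarith
      moreover from this have "?L ! i - 1 \<notin># p"
        using none_between[of "?L ! i - 1"] by fastforce
      moreover from \<open>?L ! (i + 1) < ?L ! i - 1\<close>
      have "?L ! i - ?L ! (i + 1) > 1" "?L ! i - 1 \<noteq> 0" by linarith+
      ultimately show ?thesis unfolding gap by simp
    qed
  next
    case False
    \<comment> \<open>Index \<open>i\<close> is the last one, so its size is minimal and the
      predecessor can lie in \<open>insert 0 (set_mset p)\<close> only as \<open>0\<close>.\<close>
    have "?L ! i \<le> x" if x: "x \<in># p" for x
    proof -
      obtain j where j: "j < length ?L" "x = ?L ! j"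
        using x unfolding set_part_sizes[symmetric] in_set_conv_nth by blast
      then show ?thesis
        using part_sizes_strict_antimono[of j i p] False i
        by (cases "j = i") (auto simp: less_imp_le)
    qed
    from this[of "?L ! i - 1"] pos[OF i] show ?thesis
      using False unfolding gap_at_def by auto
  qed
qed

lemma large_gaps_eq:
  assumes "0 \<notin># p"
  shows "large_gaps p = card (gap_tops (set_mset p))"
proof -
  have eq: "{i. i < length (part_sizes p) \<and> gap_at p i > 1}
      = {i. i < length (part_sizes p) \<and> part_sizes p ! i - 1 \<notin> insert 0 (set_mset p)}"
    using gap_at_gt_1_iff[OF _ assms] by blast
  then show ?thesis
    unfolding large_gaps_def gap_tops_def eq
    by (intro bij_betw_same_card[OF bij_betw_part_sizes_filter])
qed

lemma repeated_sizes_eq: "repeated_sizes p = card {x \<in> set_mset p. count p x > 1}"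
  unfolding repeated_sizes_def multiplicity_at_def
  by (rule bij_betw_same_card[OF bij_betw_part_sizes_filter])

section \<open>The degree formula\<close>

definition transfer_result :: "nat multiset \<Rightarrow> nat \<Rightarrow> nat \<Rightarrow> nat multiset" where
  "transfer_result p x y =
    filter_mset (\<lambda>z. z > 0) (add_mset 0 p - {#x, y#} + {#x - 1, y + 1#})"

text \<open>For \<open>k > 0\<close>, the length of the \<open>k\<close>-th column of the Young
  diagram, i.e. part \<open>k\<close> of the conjugate partition.\<close>

definition column :: "nat multiset \<Rightarrow> nat \<Rightarrow> nat" where
  "column p k = size (filter_mset (\<lambda>z. k \<le> z) p)"

lemma transferE:
  assumes "x > 0" "{#x, y#} \<subseteq># add_mset 0 p"
  obtains w where "add_mset 0 p = {#x, y#} + w"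
    and "transfer_result p x y = filter_mset (\<lambda>z. z > 0) ({#x - 1, y + 1#} + w)"
proof -
  obtain w where w: "add_mset 0 p = {#x, y#} + w"
    using assms(2) by (metis mset_subset_eq_exists_conv)
  show thesis
  proof (rule that[OF w])
    show "transfer_result p x y = filter_mset (\<lambda>z. z > 0) ({#x - 1, y + 1#} + w)"
      unfolding transfer_result_def w by (simp add: union_commute)
  qed
qed

text \<open>Lowering \<open>x\<close> affects column \<open>x\<close> alone, and raising
  \<open>y\<close> affects column \<open>y + 1\<close> alone. The additive form avoids truncated
  subtraction.\<close>

lemma column_transfer_result:
  assumes "x > 0" "{#x, y#} \<subseteq># add_mset 0 p" "k > 0"
  shows "column (transfer_result p x y) k + of_bool (k = x) = column p k + of_bool (k = y + 1)"
proof -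
  obtain w where w: "add_mset 0 p = {#x, y#} + w"
    and r: "transfer_result p x y = filter_mset (\<lambda>z. z > 0) ({#x - 1, y + 1#} + w)"
    using transferE[OF assms(1,2)] by blast
  have pos: "filter_mset (\<lambda>z. z > 0 \<and> k \<le> z) M = filter_mset (\<lambda>z. k \<le> z) M" for M
    using assms(3) by (intro filter_mset_cong) auto
  have "column p k = column (add_mset 0 p) k"
    using assms(3) by (simp add: column_def)
  also have "\<dots> = column w k + of_bool (k \<le> x) + of_bool (k \<le> y)"
    unfolding w by (simp add: column_def)
  finally have 1: "column p k = column w k + of_bool (k \<le> x) + of_bool (k \<le> y)" .
  have "column (transfer_result p x y) k = column ({#x - 1, y + 1#} + w) k"
    unfolding r column_def filter_filter_mset using pos
    by (metis (no_types, lifting))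
  also have "\<dots> = column w k + of_bool (k \<le> x - 1) + of_bool (k \<le> y + 1)"
    by (simp add: column_def)
  finally show ?thesis
    using 1 assms(1,3) by (auto simp: of_bool_def split: if_splits)
qed

lemma sum_mset_filter_pos: "sum_mset (filter_mset (\<lambda>z. z > 0) M) = sum_mset M"
  for M :: "nat multiset"
  by (induction M) auto

lemma transfer_result_partitions:
  assumes "x > 0" "{#x, y#} \<subseteq># add_mset 0 p" "p \<in> partitions n"
  shows "transfer_result p x y \<in> partitions n"
proof -
  obtain w where w: "add_mset 0 p = {#x, y#} + w"
    and r: "transfer_result p x y = filter_mset (\<lambda>z. z > 0) ({#x - 1, y + 1#} + w)"
    using transferE[OF assms(1,2)] by blast
  have "sum_mset (add_mset 0 p) = n"
    using assms(3) by (simp add: partitions_def)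
  then show ?thesis
    unfolding w r partitions_def using assms(1) by (simp add: sum_mset_filter_pos)
qed

text \<open>The unit goes back from \<open>y + 1\<close> to \<open>x - 1\<close>. Hence all
  neighbours of \<open>p\<close> are reached by transfers out of \<open>p\<close>.\<close>

lemma transfer_sym:
  assumes "p \<in> partitions n" "transfer p p'"
  shows "transfer p' p"
proof -
  obtain x y where xy: "x > 0" "{#x, y#} \<subseteq># add_mset 0 p" "p' = transfer_result p x y"
    using assms(2) unfolding transfer_def transfer_result_def by blast
  obtain w where w: "add_mset 0 p = {#x, y#} + w"
    and r: "p' = filter_mset (\<lambda>z. z > 0) ({#x - 1, y + 1#} + w)"
    using transferE[OF xy(1,2)] xy(3) by metis
  have p0: "0 \<notin># p" using assms(1) by (simp add: partitions_def)
  have fp: "filter_mset (\<lambda>z. z > 0) ({#x, y#} + w) = p"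
    unfolding w[symmetric] using p0
    by (simp add: filter_mset_eq_conv) (metis gr0I)
  let ?f = "filter_mset (\<lambda>z. z > 0) w"
  \<comment> \<open>For \<open>x = 1\<close> the part \<open>x - 1\<close> has been discarded, and
    the auxiliary \<open>0\<close> added to \<open>p'\<close> takes its place; otherwise that
    \<open>0\<close> is left over in \<open>v\<close>.\<close>
  define v where "v = (if x = 1 then ?f else add_mset 0 ?f)"
  have v: "add_mset 0 p' = {#y + 1, x - 1#} + v"
    using xy(1) unfolding r v_def by (auto simp: add_mset_commute)
  have "transfer_result p' (y + 1) (x - 1) = filter_mset (\<lambda>z. z > 0) ({#x, y#} + v)"
    unfolding transfer_result_def v using xy(1) by (simp add: add_mset_commute)
  also have "\<dots> = filter_mset (\<lambda>z. z > 0) ({#x, y#} + w)"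
    by (simp add: v_def filter_filter_mset)
  finally have "p = transfer_result p' (y + 1) (x - 1)" using fp by simp
  moreover have "{#y + 1, x - 1#} \<subseteq># add_mset 0 p'" unfolding v by simp
  ultimately show ?thesis
    unfolding transfer_def transfer_result_def by (metis add_gr_0 zero_less_one)
qed

text \<open>Pairs with \<open>x = y + 1\<close> are left out because such a transfer merely
  exchanges two sizes and returns \<open>p\<close>.\<close>

definition transfer_pairs :: "nat multiset \<Rightarrow> (nat \<times> nat) set" where
  "transfer_pairs p = {(x, y). x \<in># p \<and> y \<in> insert 0 (set_mset p) \<and> x \<noteq> y + 1 \<and>
     (x = y \<longrightarrow> count p x > 1)}"

lemma pair_subset_add_zero_iff:
  fixes p :: "nat multiset"
  assumes "0 \<notin># p" "x > 0"
  shows "{#x, y#} \<subseteq># add_mset 0 p \<longleftrightarrow>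
    x \<in># p \<and> y \<in> insert 0 (set_mset p) \<and> (x = y \<longrightarrow> count p x > 1)"
proof -
  have "{#x, y#} \<subseteq># add_mset 0 p \<longleftrightarrow> x \<in># p \<and> y \<in># add_mset 0 p - {#x#}"
    using assms by (simp add: insert_subset_eq_iff)
  moreover have "y \<in># add_mset 0 p - {#x#} \<longleftrightarrow>
      y \<in> insert 0 (set_mset p) \<and> (x = y \<longrightarrow> count p x > 1)" if "x \<in># p"
    using assms that
    by (cases "x = y") (auto simp: in_diff_count not_in_iff)
  ultimately show ?thesis by blast
qed

lemma transfer_pairs_iff:
  assumes "0 \<notin># p"
  shows "(x, y) \<in> transfer_pairs p \<longleftrightarrow> x > 0 \<and> x \<noteq> y + 1 \<and> {#x, y#} \<subseteq># add_mset 0 p"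
  using pair_subset_add_zero_iff[OF assms, of x y] assms
  by (cases "x = 0") (auto simp: transfer_pairs_def)

lemma transfer_result_trivial:
  assumes "0 \<notin># p" "{#y + 1, y#} \<subseteq># add_mset 0 p"
  shows "transfer_result p (y + 1) y = p"
proof -
  obtain w where w: "add_mset 0 p = {#y + 1, y#} + w"
    and r: "transfer_result p (y + 1) y = filter_mset (\<lambda>z. z > 0) ({#y + 1 - 1, y + 1#} + w)"
    using transferE[OF _ assms(2)] by (metis add_gr_0 zero_less_one)
  have "transfer_result p (y + 1) y = filter_mset (\<lambda>z. z > 0) (add_mset 0 p)"
    unfolding r w by (simp add: add_mset_commute)
  also have "\<dots> = p"
    using assms(1) by (simp add: filter_mset_eq_conv) (metis gr0I)
  finally show ?thesis .
qed

lemma neighbours_eq: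
  assumes "p \<in> partitions n"
  shows "{p'. adjacent n p p'} = (\<lambda>(x, y). transfer_result p x y) ` transfer_pairs p"
proof (intro equalityI subsetI)
  have p0: "0 \<notin># p" using assms by (simp add: partitions_def)
  fix p' assume "p' \<in> {p'. adjacent n p p'}"
  then have "p \<noteq> p'" "transfer p p'"
    unfolding adjacent_def using transfer_sym by blast+
  then obtain x y where xy: "x > 0" "{#x, y#} \<subseteq># add_mset 0 p" "p' = transfer_result p x y"
    unfolding transfer_def transfer_result_def by blast
  moreover have "x \<noteq> y + 1"
    using transfer_result_trivial[OF p0] xy \<open>p \<noteq> p'\<close> by metis
  ultimately have "(x, y) \<in> transfer_pairs p"
    using transfer_pairs_iff[OF p0] by blast
  then show "p' \<in> (\<lambda>(x, y). transfer_result p x y) ` transfer_pairs p"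
    using xy(3) by blast
next
  have p0: "0 \<notin># p" using assms by (simp add: partitions_def)
  fix p' assume "p' \<in> (\<lambda>(x, y). transfer_result p x y) ` transfer_pairs p"
  then obtain x y where p': "p' = transfer_result p x y" and xy: "(x, y) \<in> transfer_pairs p"
    by auto
  then have x: "x > 0" "x \<noteq> y + 1" and sub: "{#x, y#} \<subseteq># add_mset 0 p"
    using transfer_pairs_iff[OF p0] by blast+
  \<comment> \<open>Column \<open>x\<close> becomes shorter, as
    \<open>x \<noteq> y + 1\<close>.\<close>
  have "p \<noteq> p'"
    using column_transfer_result[OF x(1) sub x(1)] x(2) p' by auto
  moreover have "transfer p p'"
    unfolding transfer_def p' transfer_result_def using x sub by blast
  moreover have "p' \<in> partitions n"
    unfolding p' by (rule transfer_result_partitions[OF x(1) sub assms])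
  ultimately show "p' \<in> {p'. adjacent n p p'}"
    unfolding adjacent_def using assms by blast
qed

text \<open>The pair can be read off from the result: \<open>x\<close> is the only column that
  shrinks and \<open>y + 1\<close> the only one that grows.\<close>

lemma inj_on_transfer_result:
  assumes p0: "0 \<notin># p"
  shows "inj_on (\<lambda>(x, y). transfer_result p x y) (transfer_pairs p)"
proof -
  have "x = x' \<and> y = y'"
    if P: "(x, y) \<in> transfer_pairs p" "(x', y') \<in> transfer_pairs p"
      and eq: "transfer_result p x y = transfer_result p x' y'" for x y x' y'
  proof -
    have x: "x > 0" "x \<noteq> y + 1" and sub: "{#x, y#} \<subseteq># add_mset 0 p"
      using P(1) transfer_pairs_iff[OF p0] by blast+
    have x': "x' > 0" "x' \<noteq> y' + 1" and sub': "{#x', y'#} \<subseteq># add_mset 0 p"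
      using P(2) transfer_pairs_iff[OF p0] by blast+
    note c = column_transfer_result[OF x(1) sub] and c' = column_transfer_result[OF x'(1) sub']
    have "x = x'"
      using c[of x] c'[of x] x x'(1) eq by (auto simp: of_bool_def split: if_splits)
    moreover have "y = y'"
      using c[of "y + 1"] c'[of "y + 1"] x x' eq by (auto simp: of_bool_def split: if_splits)
    ultimately show ?thesis by blast
  qed
  then show ?thesis by (auto simp: inj_on_def)
qed

text \<open>Of the \<open>r * (r + 1)\<close> pairs in \<open>?S \<times> insert 0 ?S\<close>, those
  missing are the \<open>r - A\<close> pairs \<open>(x, x - 1)\<close> in \<open>?U\<close> and the
  \<open>r - B\<close> diagonal pairs of unrepeated sizes in \<open>?V\<close>.\<close>

lemma card_transfer_pairs:
  assumes p0: "0 \<notin># p"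
  shows "card (transfer_pairs p) + card (set_mset p)
    = card (set_mset p) ^ 2 + large_gaps p + repeated_sizes p"
proof -
  let ?S = "set_mset p"
  let ?C = "{x \<in> ?S. x - 1 \<in> insert 0 ?S}" and ?D = "{x \<in> ?S. \<not> count p x > 1}"
  let ?U = "(\<lambda>x. (x, x - 1)) ` ?C" and ?V = "(\<lambda>x. (x, x)) ` ?D"
  have pos: "x > 0" if "x \<in># p" for x using that p0 by (metis gr0I)
  have split: "?S \<times> insert 0 ?S = transfer_pairs p \<union> (?U \<union> ?V)"
  proof (intro set_eqI iffI)
    fix z assume "z \<in> ?S \<times> insert 0 ?S"
    then obtain x y where z: "z = (x, y)" and xy: "x \<in> ?S" "y \<in> insert 0 ?S" by blast
    show "z \<in> transfer_pairs p \<union> (?U \<union> ?V)"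
    proof (cases "x = y + 1 \<or> (x = y \<and> \<not> count p x > 1)")
      case True
      then show ?thesis
      proof
        assume "x = y + 1"
        then have "z \<in> ?U" using xy z by (intro image_eqI[of _ _ x]) auto
        then show ?thesis by blast
      qed (use xy z in blast)
    next
      case False
      then show ?thesis using xy z unfolding transfer_pairs_def by blast
    qed
  qed (auto simp: transfer_pairs_def)
  have fin: "finite (transfer_pairs p)"
    by (rule finite_subset[of _ "?S \<times> insert 0 ?S"]) (auto simp: transfer_pairs_def)
  have dis: "transfer_pairs p \<inter> (?U \<union> ?V) = {}"
    unfolding transfer_pairs_def by (auto dest: pos)
  have dis': "?U \<inter> ?V = {}"
    using pos by fastforce
  have "card (?S \<times> insert 0 ?S) = card (transfer_pairs p) + (card ?U + card ?V)"
    unfolding split using dis dis' fin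
    by (subst card_Un_disjoint) (auto simp: card_Un_disjoint)
  moreover have "card ?U = card ?C" "card ?V = card ?D"
    by (auto intro!: card_image inj_onI)
  moreover have "card ?C + large_gaps p = card ?S"
  proof -
    have "?C \<union> gap_tops ?S = ?S" "?C \<inter> gap_tops ?S = {}" by (auto simp: gap_tops_def)
    then show ?thesis
      unfolding large_gaps_eq[OF p0] by (metis card_Un_disjoint finite_Un finite_set_mset)
  qed
  moreover have "card ?D + repeated_sizes p = card ?S"
  proof -
    have "?D \<union> {x \<in> ?S. count p x > 1} = ?S" "?D \<inter> {x \<in> ?S. count p x > 1} = {}" by auto
    then show ?thesis
      unfolding repeated_sizes_eq by (metis card_Un_disjoint finite_Un finite_set_mset)
  qed
  moreover have "card (?S \<times> insert 0 ?S) = card ?S ^ 2 + card ?S"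
    using p0 by (simp add: card_cartesian_product power2_eq_square)
  ultimately show ?thesis by linarith
qed

lemma deg_formula:
  assumes "p \<in> partitions n"
  shows "deg n p + card (set_mset p) = card (set_mset p) ^ 2 + large_gaps p + repeated_sizes p"
proof -
  have p0: "0 \<notin># p" using assms by (simp add: partitions_def)
  show ?thesis
    unfolding deg_def neighbours_eq[OF assms] card_image[OF inj_on_transfer_result[OF p0]]
    by (rule card_transfer_pairs[OF p0])
qed

section \<open>The smallest partition with a given profile\<close>

lemma finite_gap_tops: "finite S \<Longrightarrow> finite (gap_tops S)"
  by (simp add: gap_tops_def)

lemma gap_tops_insert_Max:
  assumes "\<And>x. x \<in> S \<Longrightarrow> x < b"
  shows "gap_tops (insert b S) = (if b - 1 \<in> insert 0 S then gap_tops S else insert b (gap_tops S))"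
proof -
  have "b - 1 \<noteq> b \<or> b = 0" by auto
  moreover have "x - 1 \<noteq> b" if "x \<in> S" for x using assms[OF that] by auto
  ultimately show ?thesis by (auto simp: gap_tops_def)
qed

text \<open>The largest size is the sum of all gaps, each at least \<open>1\<close> and the large
  ones at least \<open>2\<close>.\<close>

lemma card_add_card_gap_tops_le_Max:
  assumes "finite S" "0 \<notin> S"
  shows "card S + card (gap_tops S) \<le> Max (insert 0 S)"
  using assms
proof (induction S rule: finite_linorder_max_induct)
  case empty
  then show ?case by (simp add: gap_tops_def)
next
  case (insert b S)
  have b: "b \<notin> S" "b \<notin> gap_tops S" "b > 0"
    using insert.hyps(2) insert.prems by (auto simp: gap_tops_def)
  define M where "M = Max (insert 0 S)"
  have M: "M \<in> insert 0 S" unfolding M_def using insert.hyps(1) by (intro Max_in) auto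
  then have "M < b" using insert.hyps(2) b(3) by auto
  \<comment> \<open>If \<open>b\<close> tops a large gap, the maximum grows by at least
    \<open>2\<close>, which pays for both cardinalities.\<close>
  moreover have "M \<noteq> b - 1" if "b - 1 \<notin> insert 0 S" using M that by metis
  moreover have "Max (insert 0 (insert b S)) = b"
    using insert.hyps by (intro Max_eqI) (auto simp: less_imp_le)
  moreover have "card S + card (gap_tops S) \<le> M" unfolding M_def using insert by auto
  ultimately show ?case
    using b insert.hyps(1) gap_tops_insert_Max[of S b] insert.hyps(2) finite_gap_tops[of S]
    by auto
qed

text \<open>Sizes are added in increasing order. By the previous lemma each new size is at least the
  new number of sizes plus the new number of large gaps, and the left side grows by no more than
  that.\<close>

lemma tri_card_le_sum:
  assumes "finite S" "0 \<notin> S"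
  shows "tri (card S) + tri (card (gap_tops S)) \<le> \<Sum>S"
  using assms
proof (induction S rule: finite_linorder_max_induct)
  case empty
  then show ?case by (simp add: gap_tops_def)
next
  case (insert b S)
  have b: "b \<notin> S" "b \<notin> gap_tops S"
    using insert.hyps(2) by (auto simp: gap_tops_def)
  have "Max (insert 0 (insert b S)) = b"
    using insert.hyps by (intro Max_eqI) (auto simp: less_imp_le)
  then have "card (insert b S) + card (gap_tops (insert b S)) \<le> b"
    using card_add_card_gap_tops_le_Max[of "insert b S"] insert by auto
  moreover have "tri (card S) + tri (card (gap_tops S)) \<le> \<Sum>S" using insert by auto
  ultimately show ?case
    using b insert.hyps(1) gap_tops_insert_Max[of S b] insert.hyps(2) finite_gap_tops[of S]
    by auto
qed

lemma sum_mset_eq_sum_count: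
  fixes M :: "nat multiset"
  assumes "finite A" "set_mset M \<subseteq> A"
  shows "sum_mset M = (\<Sum>x\<in>A. count M x * x)"
  using assms(2)
proof (induction M)
  case (add a M)
  have "(\<Sum>x\<in>A. count (add_mset a M) x * x) = (\<Sum>x\<in>A. count M x * x + (if x = a then x else 0))"
    by (intro sum.cong) auto
  then show ?case using add assms(1) by (simp add: sum.distrib)
qed simp

text \<open>One copy of every size accounts for the first two terms. A second copy of each repeated
  size accounts for the third, since these are distinct positive numbers.\<close>

lemma partition_size_ge:
  assumes "p \<in> partitions n"
  shows "tri (card (set_mset p)) + tri (large_gaps p) + tri (repeated_sizes p) \<le> n"
proof -
  have p0: "0 \<notin># p" using assms by (simp add: partitions_def)
  let ?R = "{x \<in> set_mset p. count p x > 1}"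
  have "tri (repeated_sizes p) \<le> \<Sum>?R"
    unfolding repeated_sizes_eq using tri_card_le_sum[of ?R] p0 by auto
  moreover have "tri (card (set_mset p)) + tri (large_gaps p) \<le> \<Sum>(set_mset p)"
    unfolding large_gaps_eq[OF p0] using p0 by (intro tri_card_le_sum) auto
  moreover have "\<Sum>(set_mset p) + \<Sum>?R \<le> n"
  proof -
    have "\<Sum>(set_mset p) + \<Sum>?R = (\<Sum>x\<in>set_mset p. x + (if count p x > 1 then x else 0))"
      by (simp add: sum.distrib sum.inter_filter)
    also have "\<dots> \<le> (\<Sum>x\<in>set_mset p. x * count p x)"
    proof (rule sum_mono)
      fix x assume "x \<in># p"
      then have "x * (if count p x > 1 then 2 else 1) \<le> x * count p x"
        by (intro mult_le_mono) (auto simp: Suc_le_eq)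
      moreover have "x * (if count p x > 1 then 2 else 1) = x + (if count p x > 1 then x else 0)"
        by simp
      ultimately show "x + (if count p x > 1 then x else 0) \<le> x * count p x"
        by (simp only:)
    qed
    also have "\<dots> = n"
      using assms sum_mset_eq_sum_count[of "set_mset p" p]
      by (simp add: partitions_def mult.commute)
    finally show ?thesis .
  qed
  ultimately show ?thesis by linarith
qed

lemma large_gaps_le: "large_gaps p \<le> card (set_mset p)"
  unfolding large_gaps_def length_part_sizes[symmetric]
  by (rule order_trans[OF card_mono[of "{..<length (part_sizes p)}"]]) auto

lemma repeated_sizes_le: "repeated_sizes p \<le> card (set_mset p)"
  unfolding repeated_sizes_eq by (intro card_mono) auto

section \<open>Realizing a profile\<close>

text \<open>The sizes are \<open>1, ..., c\<close> followed by
  \<open>c + 2, c + 4, ..., c + 2 * a\<close>, with \<open>1, ..., b\<close> doubled. The excess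
  \<open>e\<close> enlarges the largest size if \<open>a > 0\<close>; otherwise it becomes further
  copies of \<open>1\<close>, which is already repeated when \<open>e > 0\<close> by the second
  hypothesis.\<close>

lemma profile_exists:
  fixes a b c e :: nat
  assumes "b \<le> c" "a = 0 \<Longrightarrow> b = 0 \<Longrightarrow> e = 0"
  obtains p where "p \<in> partitions (tri (c + a) + tri a + tri b + e)"
    "card (set_mset p) = c + a" "large_gaps p = a" "repeated_sizes p = b"
proof -
  define g where "g j = c + 2 * j + (if j = a then e else 0)" for j
  define S where "S = {1..c} \<union> g ` {1..a}"
  define E :: "nat multiset" where "E = (if a = 0 then replicate_mset e 1 else {#})"
  define p where "p = mset_set S + mset_set {1..b} + E"
  have fin: "finite S" by (simp add: S_def)
  have inj: "inj_on g {1..a}" by (auto simp: inj_on_def g_def split: if_splits)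
  have dis: "{1..c} \<inter> g ` {1..a} = {}" by (auto simp: g_def)
  have bS: "{1..b} \<subseteq> S" using assms(1) by (auto simp: S_def)
  have setE: "set_mset E \<subseteq> {1..b}"
    using assms(2) by (auto simp: E_def Suc_le_eq split: if_splits)
  have S: "set_mset p = S" using fin bS setE by (auto simp: p_def)
  have S0: "0 \<notin> S" by (auto simp: S_def g_def)
  have card: "card S = c + a"
    unfolding S_def using dis inj by (simp add: card_Un_disjoint card_image)
  have "gap_tops S = g ` {1..a}"
  proof -
    have "x - 1 \<in> insert 0 S" if "x \<in> {1..c}" for x using that by (auto simp: S_def)
    moreover have "g j - 1 \<notin> insert 0 S" if j: "j \<in> {1..a}" for j
    proof -
      have "g j - 1 \<noteq> g i" if "i \<in> {1..a}" for i
      proof -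
        \<comment> \<open>Parity separates the values without excess; adding \<open>e\<close> to the
          largest only moves it further up.\<close>
        have "c + 2 * j - 1 \<noteq> c + 2 * i" using j that by (auto) presburger
        then show ?thesis using j that by (auto simp: g_def)
      qed
      then have "g j - 1 \<notin> g ` {1..a}" by blast
      moreover have "g j - 1 \<noteq> 0" "g j - 1 \<notin> {1..c}" using j by (auto simp: g_def)
      ultimately show ?thesis by (simp add: S_def)
    qed
    moreover have "x \<in> S \<longleftrightarrow> x \<in> {1..c} \<or> x \<in> g ` {1..a}" for x by (simp add: S_def)
    ultimately show ?thesis unfolding gap_tops_def by blast
  qed
  then have gaps: "large_gaps p = a"
    using large_gaps_eq[of p] S S0 card_image[OF inj] by simp
  have "{x \<in> S. count p x > 1} = {1..b}"
  proof (intro equalityI subsetI)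
    fix x assume x: "x \<in> {x \<in> S. count p x > 1}"
    show "x \<in> {1..b}"
    proof (rule ccontr)
      assume "x \<notin> {1..b}"
      moreover from this have "count E x = 0" using setE by (auto simp: count_eq_zero_iff)
      ultimately show False using x fin by (auto simp: p_def)
    qed
  next
    fix x assume "x \<in> {1..b}"
    then show "x \<in> {x \<in> S. count p x > 1}" using bS fin by (auto simp: p_def)
  qed
  then have rep: "repeated_sizes p = b" unfolding repeated_sizes_eq S by simp
  have tri_sum: "\<Sum>{1..m} = tri m" for m
    by (induction m) (auto simp: atLeastAtMostSuc_conv)
  have "\<Sum>S = tri c + (\<Sum>j\<in>{1..a}. g j)"
    unfolding S_def using dis inj tri_sum by (simp add: sum.union_disjoint sum.reindex)
  also have "(\<Sum>j\<in>{1..a}. g j) = a * c + 2 * tri a + (if a = 0 then 0 else e)"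
    by (auto simp: g_def sum.distrib tri_sum[unfolded One_nat_def] simp flip: sum_distrib_left)
  also have "tri c + \<dots> = tri (c + a) + tri a + (if a = 0 then 0 else e)"
    by (simp add: tri_add)
  finally have "sum_mset p = tri (c + a) + tri a + tri b + e"
    using tri_sum[of b] sum_unfold_sum_mset[of "\<lambda>x. x" S] sum_unfold_sum_mset[of "\<lambda>x. x" "{1..b}"]
    by (simp add: p_def E_def)
  then show thesis
    using that[of p] S S0 card gaps rep by (simp add: partitions_def)
qed

section \<open>The function \<open>rho\<close> and the maximum degree\<close>

lemma rho_ge: "tri a + tri b \<le> q \<Longrightarrow> a + b \<le> rho q"
  unfolding rho_def by (rule Max_ge[OF finite_rho_set]) blast

lemma rho_attained:
  obtains a b where "tri a + tri b \<le> q" "a + b = rho q"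
proof -
  have "rho q \<in> {a + b | a b. tri a + tri b \<le> q}"
    unfolding rho_def by (rule Max_in[OF finite_rho_set rho_set_nonempty])
  then obtain a b where "rho q = a + b" "tri a + tri b \<le> q" by blast
  with that show thesis by simp
qed

text \<open>For \<open>q > 0\<close> the pair \<open>(1, 0)\<close> is admissible.\<close>

lemma rho_eq_0: "rho q = 0 \<Longrightarrow> q = 0"
  using rho_ge[of "Suc 0" 0 q] by (cases q) simp_all

text \<open>From \<open>a + b \<le> tri a + tri b \<le> q \<le> s\<close> the \<open>b\<close>
  repeated sizes fit into the run \<open>1, ..., s - a\<close>. For \<open>a = b = 0\<close> also
  \<open>q = 0\<close>, so no excess has to be placed.\<close>

lemma predicted_profile_realized:
  assumes "tri a + tri b \<le> q" "a + b = rho q" "q \<le> s"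
  obtains p where "p \<in> partitions (tri s + q)" "card (set_mset p) = s"
    "large_gaps p = a" "repeated_sizes p = b"
proof -
  have ab: "a + b \<le> s" using assms le_tri[of a] le_tri[of b] by linarith
  have "q - tri a - tri b = 0" if "a = 0" "b = 0"
    using that assms(2) rho_eq_0[of q] by simp
  with profile_exists[of b "s - a" a "q - tri a - tri b"] ab
  obtain p where "p \<in> partitions (tri (s - a + a) + tri a + tri b + (q - tri a - tri b))"
    "card (set_mset p) = s - a + a" "large_gaps p = a" "repeated_sizes p = b"
    by (metis le_diff_conv2 add.commute add_leD1)
  with that show thesis using ab assms(1) by simp
qed

text \<open>
  For fewer than \<open>s\<close> sizes, only \<open>r = s - 1\<close> with \<open>A = B = r\<close> can reach degree \<open>s (s - 1)\<close>. The size
  bound excludes it for \<open>s \<ge> 3\<close>; the cases \<open>n = 1\<close> and \<open>n = 3\<close> need a direct argument.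
\<close>

lemma few_sizes_deg_less:
  assumes "s \<ge> 1" "p \<in> partitions (tri s + q)" "card (set_mset p) < s"
  shows "deg (tri s + q) p < s * (s - 1) + rho q"
proof (rule ccontr)
  let ?r = "card (set_mset p)" and ?A = "large_gaps p" and ?B = "repeated_sizes p"
  assume "\<not> ?thesis"
  then have ge: "s * (s - 1) + rho q \<le> deg (tri s + q) p" by simp
  have p0: "0 \<notin># p" using assms(2) by (simp add: partitions_def)
  obtain t where t: "s = Suc t" using assms(1) by (cases s) auto
  have r: "?r \<le> t" using assms(3) t by simp
  have d: "deg (tri s + q) p + ?r = ?r * ?r + ?A + ?B"
    using deg_formula[OF assms(2)] by (simp add: power2_eq_square)
  have rr: "?r * ?r \<le> ?r * t" "?r * t \<le> t * t" using r by auto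
  \<comment> \<open>Since \<open>?A\<close> and \<open>?B\<close> are at most \<open>?r\<close>,
    this leaves \<open>t * t + t + rho q \<le> ?r * ?r + ?r\<close>, and \<open>?r \<le> t\<close>
    forces equality everywhere.\<close>
  have "t * t + t + rho q + ?r \<le> ?r * ?r + ?A + ?B"
    using ge d t by simp
  then have "rho q = 0" "?r = t" "?A = t" "?B = t"
    using rr r large_gaps_le[of p] repeated_sizes_le[of p] by linarith+
  then have q: "q = 0" using rho_eq_0 by simp
  have "3 * tri t \<le> tri t + t + 1"
    using partition_size_ge[OF assms(2)] \<open>?r = t\<close> \<open>?A = t\<close> \<open>?B = t\<close> q t by simp
  then have "2 * tri t \<le> t + 1" by linarith
  then have "t * (t + 1) \<le> 1 * (t + 1)" unfolding double_tri mult_1 .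
  then have "t \<le> 1" unfolding mult_le_cancel2 by simp
  moreover have "t \<noteq> 0"
  proof
    assume "t = 0"
    then have "p = {#}" using \<open>?r = t\<close> by simp
    then show False using assms(2) t by (simp add: partitions_def)
  qed
  ultimately have t1: "t = 1" by simp
  then obtain x where x: "set_mset p = {x}" using \<open>?r = t\<close> card_1_singletonE by metis
  \<comment> \<open>Now \<open>n = 3\<close>, but a single size that is at least \<open>2\<close>
    and repeated needs \<open>n \<ge> 4\<close>.\<close>
  have "gap_tops {x} \<noteq> {}" using large_gaps_eq[OF p0] x \<open>?A = t\<close> t1 by auto
  then have x2: "x \<ge> 2" by (auto simp: gap_tops_def)
  have "{y \<in> {x}. count p y > 1} \<noteq> {}"
    using repeated_sizes_eq[of p] x \<open>?B = t\<close> t1 by (metis card.empty zero_neq_one)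
  then have "count p x \<ge> 2" by auto
  then have "2 * 2 \<le> count p x * x" using x2 by (intro mult_le_mono)
  moreover have "count p x * x = 3"
    using assms(2) x t1 t q sum_mset_eq_sum_count[of "{x}" p] by (simp add: partitions_def)
  ultimately show False by simp
qed

text \<open>With \<open>s + 1\<close> sizes the partition would have size at least
  \<open>tri s + s + 1\<close>, more than \<open>tri s + q\<close>.\<close>

lemma card_sizes_le:
  assumes "q \<le> s" "p \<in> partitions (tri s + q)"
  shows "card (set_mset p) \<le> s"
proof (rule ccontr)
  assume "\<not> ?thesis"
  then have "tri (Suc s) \<le> tri (card (set_mset p))" by (intro tri_mono) simp
  then show False using partition_size_ge[OF assms(2)] assms(1) by simp
qed

text \<open>With exactly \<open>s\<close> sizes the degree is \<open>s * (s - 1) + A + B\<close>,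
  and the size bound leaves \<open>tri A + tri B \<le> q\<close>, so
  \<open>A + B \<le> rho q\<close>. A realized predicted profile attains this.\<close>

lemma max_deg_eq:
  assumes "s \<ge> 1" "q \<le> s"
  shows "max_deg (tri s + q) = s * (s - 1) + rho q"
  unfolding max_deg_def
proof (rule Max_eqI)
  show "finite (deg (tri s + q) ` partitions (tri s + q))" by (simp add: finite_partitions)
next
  fix d assume "d \<in> deg (tri s + q) ` partitions (tri s + q)"
  then obtain p where p: "p \<in> partitions (tri s + q)" and d: "d = deg (tri s + q) p" by blast
  show "d \<le> s * (s - 1) + rho q"
  proof (cases "card (set_mset p) = s")
    case True
    then have "large_gaps p + repeated_sizes p \<le> rho q"
      using partition_size_ge[OF p] by (intro rho_ge) simp
    then show ?thesis
      using deg_formula[OF p] True d by (simp add: power2_eq_square diff_mult_distrib2)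
  next
    case False
    then show ?thesis
      using few_sizes_deg_less[OF assms(1) p] card_sizes_le[OF assms(2) p] d by simp
  qed
next
  obtain a b where ab: "tri a + tri b \<le> q" "a + b = rho q" by (rule rho_attained)
  obtain p where p: "p \<in> partitions (tri s + q)" "card (set_mset p) = s"
    "large_gaps p = a" "repeated_sizes p = b"
    using predicted_profile_realized[OF ab assms(2)] by blast
  then have "deg (tri s + q) p = s * (s - 1) + rho q"
    using deg_formula[OF p(1)] ab(2) assms(1) by (cases s) (auto simp: power2_eq_square)
  then show "s * (s - 1) + rho q \<in> deg (tri s + q) ` partitions (tri s + q)"
    using p(1) by (metis image_eqI)
qed

theorem theorem5p3:
  fixes s q n :: nat
  assumes "s \<ge> 1" and "q \<le> s" and "n = tri s + q"
  shows "maximizing_profiles n = predicted_profiles q"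
proof (intro equalityI subsetI)
  fix z assume "z \<in> maximizing_profiles n"
  then obtain p where p: "p \<in> partitions (tri s + q)"
    and d: "deg (tri s + q) p = s * (s - 1) + rho q"
    and z: "z = (large_gaps p, repeated_sizes p)"
    unfolding maximizing_profiles_def maximizers_def assms(3) max_deg_eq[OF assms(1,2)] by blast
  \<comment> \<open>The strict inequality for fewer sizes is essential here: it excludes further
    maximizers.\<close>
  have r: "card (set_mset p) = s"
    using few_sizes_deg_less[OF assms(1) p] card_sizes_le[OF assms(2) p] d by fastforce
  have "large_gaps p + repeated_sizes p = rho q"
    using deg_formula[OF p] d r assms(1) by (cases s) (auto simp: power2_eq_square)
  moreover have "tri (large_gaps p) + tri (repeated_sizes p) \<le> q"
    using partition_size_ge[OF p] r by simp
  ultimately show "z \<in> predicted_profiles q"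
    unfolding predicted_profiles_def z by blast
next
  fix z assume "z \<in> predicted_profiles q"
  then obtain a b where z: "z = (a, b)" and ab: "tri a + tri b \<le> q" "a + b = rho q"
    unfolding predicted_profiles_def by blast
  obtain p where p: "p \<in> partitions (tri s + q)" "card (set_mset p) = s"
    "large_gaps p = a" "repeated_sizes p = b"
    using predicted_profile_realized[OF ab assms(2)] by blast
  then have "deg (tri s + q) p = s * (s - 1) + rho q"
    using deg_formula[OF p(1)] ab(2) assms(1) by (cases s) (auto simp: power2_eq_square)
  then have "p \<in> maximizers n"
    unfolding maximizers_def assms(3) max_deg_eq[OF assms(1,2)] using p(1) by blast
  then show "z \<in> maximizing_profiles n"
    unfolding maximizing_profiles_def z using p(3,4) by (metis (mono_tags, lifting) image_eqI)
qed

end
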